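(* Let $\mathcal H$ be a finite-dimensional complex Hilbert space, viewed as an object of the $C^*$-tensor category of finite-dimensional Hilbert spaces and linear maps (with tensor unit $\mathbb C$). (a) There is a one-to-one correspondence between solutions $\mathrm{ev}_{\mathcal H}:\mathcal H\otimes\mathcal H\to\mathbb C$, $\mathrm{coev}_{\mathcal H}:\mathbb C\to\mathcal H\otimes\mathcal H$ (linear maps) of the conjugate equations $$(1_{\mathcal H}\otimes\mathrm{ev}_{\mathcal H})(\mathrm{coev}_{\mathcal H}\otimes1_{\mathcal H})=1_{\mathcal H},\qquad(\mathrm{ev}_{\mathcal H}\otimes1_{\mathcal H})(1_{\mathcal H}\otimes\mathrm{coev}_{\mathcal H})=1_{\mathcal H}$$ with $\mathrm{coev}_{\mathcal H}=\mathrm{ev}_{\mathcal H}^*$, and antilinear involutions $S$ on $\mathcal H$. This correspondence is given by $$\mathrm{ev}_{\mathcal H}(v\otimes w)=\langle Sv,w\rangle,\quad v,w\in\mathcal H,\qquad\mathrm{coev}_{\mathcal H}(\lambda)=\lambda\sum_ne_n\otimes Se_n,\quad\lambda\in\mathbb C,$$ where $\{e_n\}_n$ is an arbitrary orthonormal basis of $\mathcal H$. (b) Let $S$ be an antilinear involution on $\mathcal H$ and consider the solution of the conjugate equations corresponding to $S$ under the bijection in (a). Then the corresponding categorical crossing map $\mathrm{CatCr}_{\mathcal H}$ coincides with the Hilbert space crossing map $\mathrm{Cr}_S$ (on all of $\mathcal B(\mathcal H\otimes\mathcal H)$).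
   Context: Inner products are antilinear in the first and linear in the second argument. Antilinear involution means an antilinear map $S:\mathcal H\to\mathcal H$ with $S^2=1$ (not necessarily antiunitary); $S^*$ is defined by $\langle v,Sw\rangle=\langle w,S^*v\rangle$. Categorical crossing map: given linear maps $\mathrm{ev}_{\mathcal H}:\mathcal H\otimes\mathcal H\to\mathbb C$ and $\mathrm{coev}_{\mathcal H}:\mathbb C\to\mathcal H\otimes\mathcal H$ with $\mathrm{coev}_{\mathcal H}=\mathrm{ev}_{\mathcal H}^*$ that solve the conjugate equations $$(1_{\mathcal H}\otimes\mathrm{ev}_{\mathcal H})(\mathrm{coev}_{\mathcal H}\otimes1_{\mathcal H})=1_{\mathcal H},\qquad(\mathrm{ev}_{\mathcal H}\otimes1_{\mathcal H})(1_{\mathcal H}\otimes\mathrm{coev}_{\mathcal H})=1_{\mathcal H},$$ for linear $T:\mathcal H\otimes\mathcal H\to\mathcal H\otimes\mathcal H$, $$\mathrm{CatCr}_{\mathcal H}(T):=(1_{\mathcal H\otimes\mathcal H}\otimes\mathrm{ev}_{\mathcal H})(1_{\mathcal H}\otimes T\otimes1_{\mathcal H})(\mathrm{coev}_{\mathcal H}\otimes1_{\mathcal H\otimes\mathcal H}).$$ Hilbert space crossing map: for $T\in\mathcal B(\mathcal H\otimes\mathcal H)$, $\mathrm{Cr}_S(T)$ is the unique operator with $$\langle\varphi_1\otimes\varphi_2,\,\mathrm{Cr}_S(T)(\psi_1\otimes\psi_2)\rangle=\langle\varphi_2\otimes S^*\psi_2,\,T(S\varphi_1\otimes\psi_1)\rangle,\qquad\varphi_1,\varphi_2,\psi_1,\psi_2\in\mathcal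 H.$$ *)

theory Defs
  imports Complex_Main
begin

section \<open>Finite-dimensional complex Hilbert spaces\<close>

class complex_vector = ab_group_add +
  fixes scaleC :: "complex \<Rightarrow> 'a \<Rightarrow> 'a"  (infixr "*\<^sub>C" 75)
  assumes scaleC_add_right: "a *\<^sub>C (x + y) = a *\<^sub>C x + a *\<^sub>C y"
    and scaleC_add_left: "(a + b) *\<^sub>C x = a *\<^sub>C x + b *\<^sub>C x"
    and scaleC_scaleC: "a *\<^sub>C b *\<^sub>C x = (a * b) *\<^sub>C x"
    and scaleC_one: "1 *\<^sub>C x = x"

global_interpretation complex_vector: vector_space "scaleC :: complex \<Rightarrow> 'a \<Rightarrow> 'a::complex_vector"
  by unfold_locales (simp_all add: scaleC_add_right scaleC_add_left scaleC_scaleC scaleC_one)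

abbreviation cspan :: "'a::complex_vector set \<Rightarrow> 'a set"
  where "cspan \<equiv> module.span scaleC"

abbreviation clinear :: "('a::complex_vector \<Rightarrow> 'b::complex_vector) \<Rightarrow> bool"
  where "clinear \<equiv> Vector_Spaces.linear scaleC scaleC"

definition antilinear :: "('a::complex_vector \<Rightarrow> 'b::complex_vector) \<Rightarrow> bool" where
  "antilinear f \<longleftrightarrow> (\<forall>x y. f (x + y) = f x + f y) \<and> (\<forall>c x. f (c *\<^sub>C x) = cnj c *\<^sub>C f x)"

definition cbilinear ::
  "('a::complex_vector \<Rightarrow> 'b::complex_vector \<Rightarrow> 'c::complex_vector) \<Rightarrow> bool" where
  "cbilinear \<beta> \<longleftrightarrow> (\<forall>v. clinear (\<beta> v)) \<and> (\<forall>w. clinear (\<lambda>v. \<beta> v w))"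

text \<open>
  The inner product is antilinear in its first and linear in its second argument.  A
  finite-dimensional inner product space is automatically complete, and every linear map between
  such spaces is bounded, so no topology is needed: \<open>\<B>(\<H>)\<close> is the set of all linear maps
  \<open>\<H> \<rightarrow> \<H>\<close>.  The space of dimension zero is not excluded.
\<close>

class complex_inner = complex_vector +
  fixes cinner :: "'a \<Rightarrow> 'a \<Rightarrow> complex"  ("\<langle>_,/ _\<rangle>")
  assumes cinner_commute: "\<langle>x, y\<rangle> = cnj \<langle>y, x\<rangle>"
    and cinner_add_right: "\<langle>x, y + z\<rangle> = \<langle>x, y\<rangle> + \<langle>x, z\<rangle>"
    and cinner_scaleC_right: "\<langle>x, c *\<^sub>C y\<rangle> = c * \<langle>x, y\<rangle>"
    and cinner_ge_zero: "0 \<le> Re \<langle>x, x\<rangle>"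
    and cinner_eq_zero: "\<langle>x, x\<rangle> = 0 \<Longrightarrow> x = 0"

class fd_hilbert = complex_inner +
  assumes finite_dimensional: "\<exists>B. finite B \<and> (\<forall>x. \<exists>c. x = (\<Sum>b\<in>B. c b *\<^sub>C b))"

definition orthonormal :: "'a::fd_hilbert set \<Rightarrow> bool" where
  "orthonormal E \<longleftrightarrow> (\<forall>x\<in>E. \<forall>y\<in>E. \<langle>x, y\<rangle> = (if x = y then 1 else 0))"

definition orthonormal_basis :: "'a::fd_hilbert set \<Rightarrow> bool" where
  "orthonormal_basis E \<longleftrightarrow> finite E \<and> orthonormal E \<and> cspan E = UNIV"

definition some_onb :: "'a::fd_hilbert set" where
  "some_onb = (SOME E. orthonormal_basis E)"

lemma clinear_iff:
  "clinear f \<longleftrightarrow> (\<forall>x y. f (x + y) = f x + f y) \<and> (\<forall>c x. f (c *\<^sub>C x) = c *\<^sub>C f x)"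
  unfolding Vector_Spaces.linear_def module_hom_def module_hom_axioms_def
  by (simp add: complex_vector.vector_space_axioms complex_vector.module_axioms)

lemma clinear_sum: "clinear f \<Longrightarrow> f (\<Sum>i\<in>A. g i) = (\<Sum>i\<in>A. f (g i))"
  by (metis module_hom.sum linear_iff_module_hom)

lemma antilinear_zero: "antilinear f \<Longrightarrow> f 0 = 0"
  unfolding antilinear_def by (metis add_cancel_right_right)

lemma antilinear_sum:
  assumes "antilinear f" shows "f (\<Sum>i\<in>A. g i) = (\<Sum>i\<in>A. f (g i))"
  using assms
  by (induction A rule: infinite_finite_induct) (auto simp: antilinear_zero antilinear_def)

lemma clinear_cinner_right_aux:
  "\<langle>x, 0\<rangle> = 0" "\<langle>x, y - z\<rangle> = \<langle>x, y\<rangle> - \<langle>x, z\<rangle>" "\<langle>x, sum g A\<rangle> = (\<Sum>i\<in>A. \<langle>x, g i\<rangle>)"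
proof -
  show z: "\<langle>x, 0\<rangle> = 0" using cinner_add_right[of x 0 0] by simp
  show "\<langle>x, y - z\<rangle> = \<langle>x, y\<rangle> - \<langle>x, z\<rangle>" using cinner_add_right[of x "y - z" z] by simp
  show "\<langle>x, sum g A\<rangle> = (\<Sum>i\<in>A. \<langle>x, g i\<rangle>)"
    by (induction A rule: infinite_finite_induct) (auto simp: z cinner_add_right)
qed

lemma cinner_left_aux:
  "\<langle>0, x\<rangle> = 0" "\<langle>x + y, z\<rangle> = \<langle>x, z\<rangle> + \<langle>y, z\<rangle>" "\<langle>c *\<^sub>C x, z\<rangle> = cnj c * \<langle>x, z\<rangle>"
  "\<langle>sum g A, x\<rangle> = (\<Sum>i\<in>A. \<langle>g i, x\<rangle>)"
proof -
  show "\<langle>0, x\<rangle> = 0" using cinner_commute[of 0 x] by (simp add: clinear_cinner_right_aux)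
  show "\<langle>x + y, z\<rangle> = \<langle>x, z\<rangle> + \<langle>y, z\<rangle>"
    by (subst (1 2 3) cinner_commute) (simp add: cinner_add_right)
  show "\<langle>c *\<^sub>C x, z\<rangle> = cnj c * \<langle>x, z\<rangle>"
    by (subst (1 2) cinner_commute) (simp add: cinner_scaleC_right)
  show "\<langle>sum g A, x\<rangle> = (\<Sum>i\<in>A. \<langle>g i, x\<rangle>)"
    by (subst (1 2) cinner_commute) (simp add: clinear_cinner_right_aux)
qed

lemmas cinner_simps = clinear_cinner_right_aux cinner_left_aux cinner_add_right cinner_scaleC_right

lemma gram_schmidt:
  assumes "finite (B :: 'a::fd_hilbert set)"
  shows "\<exists>E. finite E \<and> orthonormal E \<and> cspan E = cspan B"
  using assms
proof (induction B)
  case empty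
  show ?case by (rule exI[of _ "{}"]) (simp add: orthonormal_def)
next
  case (insert b B)
  then obtain E where E: "finite E" "orthonormal E" "cspan E = cspan B" by auto
  define p where "p = (\<Sum>e\<in>E. \<langle>e, b\<rangle> *\<^sub>C e)"
  define d where "d = b - p"
  have p: "p \<in> cspan E"
    unfolding p_def by (intro complex_vector.span_sum complex_vector.span_scale complex_vector.span_base)
  have orth: "\<langle>e, d\<rangle> = 0" if "e \<in> E" for e
  proof -
    have "\<langle>e, p\<rangle> = (\<Sum>f\<in>E. if e = f then \<langle>e, b\<rangle> else 0)"
      using E(2) that unfolding p_def orthonormal_def
      by (auto simp: cinner_simps intro!: sum.cong)
    then show ?thesis using that E(1) by (simp add: d_def cinner_simps)
  qed
  have spanI: "cspan (insert b B) = cspan (insert b E)"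
    using E(3) by (simp add: complex_vector.span_insert)
  show ?case
  proof (cases "d = 0")
    case True
    then have "b \<in> cspan E" using p by (simp add: d_def)
    then show ?thesis using E spanI complex_vector.span_redundant by metis
  next
    case False
    define r where "r = Re \<langle>d, d\<rangle>"
    have dr: "\<langle>d, d\<rangle> = complex_of_real r"
      using cinner_commute[of d d] unfolding r_def by (simp add: complex_eq_iff)
    have r: "r > 0"
      using cinner_ge_zero[of d] cinner_eq_zero[of d] False dr unfolding r_def
      by (metis less_eq_real_def of_real_0)
    define c where "c = complex_of_real (1 / sqrt r)"
    have c0: "c \<noteq> 0" using r by (simp add: c_def)
    define u where "u = c *\<^sub>C d"
    have "\<langle>u, u\<rangle> = cnj c * (c * complex_of_real r)"
      unfolding u_def by (simp add: cinner_simps dr mult_ac)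
    also have "\<dots> = complex_of_real (1 / sqrt r * (1 / sqrt r) * r)"
      unfolding c_def by (simp only: complex_cnj_complex_of_real of_real_mult mult.assoc)
    also have "1 / sqrt r * (1 / sqrt r) * r = 1" using r by simp
    finally have uu: "\<langle>u, u\<rangle> = 1" by simp
    have ue: "\<langle>e, u\<rangle> = 0" if "e \<in> E" for e
      using orth[OF that] by (simp add: u_def cinner_simps)
    have eu: "\<langle>u, e\<rangle> = 0" if "e \<in> E" for e
      using ue[OF that] cinner_commute[of u e] by simp
    have "orthonormal (insert u E)"
      using E(2) uu ue eu unfolding orthonormal_def by fastforce
    moreover have "cspan (insert u E) = cspan (insert b E)"
    proof (subst complex_vector.span_eq, intro conjI subsetI)
      fix x assume "x \<in> insert b E"
      have "b = inverse c *\<^sub>C u + p"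
        using c0 by (simp add: u_def d_def scaleC_scaleC scaleC_one)
      moreover have "inverse c *\<^sub>C u + p \<in> cspan (insert u E)"
        using p complex_vector.span_mono[of E "insert u E"]
        by (intro complex_vector.span_add complex_vector.span_scale)
          (auto intro: complex_vector.span_base)
      ultimately show "x \<in> cspan (insert u E)"
        using \<open>x \<in> insert b E\<close> by (auto intro: complex_vector.span_base)
    next
      fix x assume "x \<in> insert u E"
      have "u \<in> cspan (insert b E)"
        unfolding u_def d_def
        using p complex_vector.span_mono[of E "insert b E"]
        by (intro complex_vector.span_scale complex_vector.span_diff)
          (auto intro: complex_vector.span_base)
      then show "x \<in> cspan (insert b E)"
        using \<open>x \<in> insert u E\<close> by (auto intro: complex_vector.span_base)
    qed
    ultimately show ?thesis using E(1) spanI by (intro exI[of _ "insert u E"]) simp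
  qed
qed

lemma some_onb: "orthonormal_basis (some_onb :: 'a::fd_hilbert set)"
proof -
  obtain B :: "'a set" where B: "finite B" "\<And>x. \<exists>c. x = (\<Sum>b\<in>B. c b *\<^sub>C b)"
    using finite_dimensional by blast
  then have "cspan B = UNIV" by (auto simp: complex_vector.span_finite)
  then have "\<exists>E :: 'a set. orthonormal_basis E"
    using gram_schmidt[OF B(1)] unfolding orthonormal_basis_def by metis
  then show ?thesis unfolding some_onb_def by (rule someI_ex)
qed

lemma onb_expand:
  assumes "orthonormal_basis E" shows "(\<Sum>e\<in>E. \<langle>e, x\<rangle> *\<^sub>C e) = x"
proof -
  have fin: "finite E" and "x \<in> cspan E" using assms by (auto simp: orthonormal_basis_def)
  then obtain c where x: "x = (\<Sum>e\<in>E. c e *\<^sub>C e)"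
    using complex_vector.span_finite[OF fin] by auto
  have "\<langle>e, x\<rangle> = c e" if "e \<in> E" for e
  proof -
    have "\<langle>e, x\<rangle> = (\<Sum>f\<in>E. c f * \<langle>e, f\<rangle>)"
      unfolding x by (simp add: cinner_simps)
    also have "\<dots> = (\<Sum>f\<in>E. if e = f then c f else 0)"
      using assms that by (intro sum.cong) (auto simp: orthonormal_basis_def orthonormal_def)
    finally show ?thesis using that fin by simp
  qed
  then show ?thesis using x by simp
qed

lemma cinner_ext: "(\<And>x. \<langle>x, y\<rangle> = \<langle>x, z\<rangle>) \<Longrightarrow> y = z"
  using cinner_eq_zero[of "y - z"] by (simp add: cinner_simps)

lemma parseval:
  assumes "orthonormal_basis E" shows "(\<Sum>e\<in>E. \<langle>x, e\<rangle> * \<langle>e, y\<rangle>) = \<langle>x, y\<rangle>"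
  by (subst (3) onb_expand[OF assms, symmetric]) (simp add: cinner_simps mult.commute)

instantiation complex :: fd_hilbert
begin
definition scaleC_complex :: "complex \<Rightarrow> complex \<Rightarrow> complex" where "scaleC_complex = (*)"
definition cinner_complex :: "complex \<Rightarrow> complex \<Rightarrow> complex" where "cinner_complex x y = cnj x * y"
instance
proof
  show "\<exists>B::complex set. finite B \<and> (\<forall>x. \<exists>c. x = (\<Sum>b\<in>B. c b *\<^sub>C b))"
    by (intro exI[of _ "{1}"]) (auto simp: scaleC_complex_def)
qed (auto simp: scaleC_complex_def cinner_complex_def algebra_simps)
end


section \<open>Adjoints\<close>

definition cadjoint :: "('a::fd_hilbert \<Rightarrow> 'b::fd_hilbert) \<Rightarrow> ('b \<Rightarrow> 'a)" where
  "cadjoint A = (THE B. \<forall>v w. \<langle>v, A w\<rangle> = \<langle>B v, w\<rangle>)"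

definition antiadjoint :: "('a::fd_hilbert \<Rightarrow> 'b::fd_hilbert) \<Rightarrow> ('b \<Rightarrow> 'a)" where
  "antiadjoint S = (THE B. \<forall>v w. \<langle>v, S w\<rangle> = \<langle>w, B v\<rangle>)"

lemma cadjoint:
  assumes "clinear A" shows "\<langle>v, A w\<rangle> = \<langle>cadjoint A v, w\<rangle>"
proof -
  let ?P = "\<lambda>B. \<forall>v w. \<langle>v, A w\<rangle> = \<langle>B v, w\<rangle>"
  have "\<exists>!B. ?P B"
  proof (rule ex1I)
    show "?P (\<lambda>v. \<Sum>e\<in>some_onb. \<langle>A e, v\<rangle> *\<^sub>C e)"
    proof (intro allI)
      fix v w
      have "\<langle>v, A w\<rangle> = \<langle>v, A (\<Sum>e\<in>some_onb. \<langle>e, w\<rangle> *\<^sub>C e)\<rangle>"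
        by (simp only: onb_expand[OF some_onb])
      also have "\<dots> = (\<Sum>e\<in>some_onb. \<langle>e, w\<rangle> * \<langle>v, A e\<rangle>)"
        using assms by (simp add: clinear_sum clinear_iff cinner_simps)
      also have "\<dots> = \<langle>(\<Sum>e\<in>some_onb. \<langle>A e, v\<rangle> *\<^sub>C e), w\<rangle>"
        by (simp add: cinner_simps mult.commute cinner_commute[symmetric])
      finally show "\<langle>v, A w\<rangle> = \<langle>(\<Sum>e\<in>some_onb. \<langle>A e, v\<rangle> *\<^sub>C e), w\<rangle>" .
    qed
    then show "B = (\<lambda>v. \<Sum>e\<in>some_onb. \<langle>A e, v\<rangle> *\<^sub>C e)" if B: "?P B" for B
    proof (rule_tac ext, rule_tac cinner_ext)
      fix v x
      assume P: "?P (\<lambda>v. \<Sum>e\<in>some_onb. \<langle>A e, v\<rangle> *\<^sub>C e)"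
      have "\<langle>B v, x\<rangle> = \<langle>\<Sum>e\<in>some_onb. \<langle>A e, v\<rangle> *\<^sub>C e, x\<rangle>"
        using B P by simp
      then show "\<langle>x, B v\<rangle> = \<langle>x, \<Sum>e\<in>some_onb. \<langle>A e, v\<rangle> *\<^sub>C e\<rangle>"
        by (simp only: cinner_commute[of x])
    qed
  qed
  from theI'[OF this] show ?thesis unfolding cadjoint_def by blast
qed

lemma antiadjoint:
  assumes "antilinear S" shows "\<langle>v, S w\<rangle> = \<langle>w, antiadjoint S v\<rangle>"
proof -
  let ?P = "\<lambda>B. \<forall>v w. \<langle>v, S w\<rangle> = \<langle>w, B v\<rangle>"
  have "\<exists>!B. ?P B"
  proof (rule ex1I)
    show "?P (\<lambda>v. \<Sum>e\<in>some_onb. \<langle>v, S e\<rangle> *\<^sub>C e)"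
    proof (intro allI)
      fix v w
      have "\<langle>v, S w\<rangle> = \<langle>v, S (\<Sum>e\<in>some_onb. \<langle>e, w\<rangle> *\<^sub>C e)\<rangle>"
        by (simp only: onb_expand[OF some_onb])
      also have "\<dots> = (\<Sum>e\<in>some_onb. cnj \<langle>e, w\<rangle> * \<langle>v, S e\<rangle>)"
        using assms by (simp add: antilinear_sum) (simp add: antilinear_def cinner_simps)
      also have "\<dots> = \<langle>w, \<Sum>e\<in>some_onb. \<langle>v, S e\<rangle> *\<^sub>C e\<rangle>"
        by (simp add: cinner_simps mult.commute cinner_commute[symmetric])
      finally show "\<langle>v, S w\<rangle> = \<langle>w, \<Sum>e\<in>some_onb. \<langle>v, S e\<rangle> *\<^sub>C e\<rangle>" .
    qed
    then show "B = (\<lambda>v. \<Sum>e\<in>some_onb. \<langle>v, S e\<rangle> *\<^sub>C e)" if "?P B" for B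
      using that by - (rule ext, rule cinner_ext, metis)
  qed
  from theI'[OF this] show ?thesis unfolding antiadjoint_def by blast
qed


section \<open>The Hilbert space tensor product\<close>

text \<open>
  The tensor product is realised as the space of functionals on \<open>\<H> \<times> \<K>\<close> that are antilinear in
  both arguments, where \<open>v \<otimes> w\<close> is \<open>(x, y) \<mapsto> \<langle>x, v\<rangle> \<langle>y, w\<rangle>\<close>.  That this is the tensor product of
  Hilbert spaces is the content of the lemmas \<open>tensor_bilinear\<close>, \<open>cinner_tensor\<close>,
  \<open>tensor_span\<close> and the universal property \<open>tensor_lift\<close> below.
\<close>

typedef (overloaded) ('a, 'b) tensor =
  "{F :: 'a::fd_hilbert \<Rightarrow> 'b::fd_hilbert \<Rightarrow> complex.
      (\<forall>x. antilinear (F x)) \<and> (\<forall>y. antilinear (\<lambda>x. F x y))}"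
  by (rule exI[of _ "\<lambda>_ _. 0"]) (simp add: antilinear_def scaleC_complex_def)

lemma Rep_tensor_antilinear:
  "antilinear (Rep_tensor F x)" "antilinear (\<lambda>x. Rep_tensor F x y)"
  using Rep_tensor[of F] by auto

lemma tensor_eqI: "(\<And>x y. Rep_tensor F x y = Rep_tensor G x y) \<Longrightarrow> F = G"
  by (metis Rep_tensor_inject ext)

definition tensor_vec :: "'a::fd_hilbert \<Rightarrow> 'b::fd_hilbert \<Rightarrow> ('a, 'b) tensor"  (infixr "\<otimes>\<^sub>v" 70) where
  "v \<otimes>\<^sub>v w = Abs_tensor (\<lambda>x y. \<langle>x, v\<rangle> * \<langle>y, w\<rangle>)"

lemma Rep_tensor_vec: "Rep_tensor (v \<otimes>\<^sub>v w) x y = \<langle>x, v\<rangle> * \<langle>y, w\<rangle>"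
  unfolding tensor_vec_def
  by (subst Abs_tensor_inverse)
    (auto simp: antilinear_def scaleC_complex_def cinner_simps algebra_simps)

instantiation tensor :: (fd_hilbert, fd_hilbert) complex_vector
begin

definition zero_tensor :: "('a, 'b) tensor" where
  "0 = Abs_tensor (\<lambda>x y. 0)"
definition plus_tensor :: "('a, 'b) tensor \<Rightarrow> ('a, 'b) tensor \<Rightarrow> ('a, 'b) tensor" where
  "F + G = Abs_tensor (\<lambda>x y. Rep_tensor F x y + Rep_tensor G x y)"
definition minus_tensor :: "('a, 'b) tensor \<Rightarrow> ('a, 'b) tensor \<Rightarrow> ('a, 'b) tensor" where
  "F - G = Abs_tensor (\<lambda>x y. Rep_tensor F x y - Rep_tensor G x y)"
definition uminus_tensor :: "('a, 'b) tensor \<Rightarrow> ('a, 'b) tensor" where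
  "- F = Abs_tensor (\<lambda>x y. - Rep_tensor F x y)"
definition scaleC_tensor :: "complex \<Rightarrow> ('a, 'b) tensor \<Rightarrow> ('a, 'b) tensor" where
  "c *\<^sub>C F = Abs_tensor (\<lambda>x y. c * Rep_tensor F x y)"

lemma Rep_tensor_simps:
  fixes F G :: "('a, 'b) tensor"
  shows "Rep_tensor (0 :: ('a, 'b) tensor) x y = 0"
    "Rep_tensor (F + G) x y = Rep_tensor F x y + Rep_tensor G x y"
    "Rep_tensor (F - G) x y = Rep_tensor F x y - Rep_tensor G x y"
    "Rep_tensor (- F) x y = - Rep_tensor F x y"
    "Rep_tensor (c *\<^sub>C F) x y = c * Rep_tensor F x y"
  using Rep_tensor_antilinear[of F] Rep_tensor_antilinear[of G]
  unfolding zero_tensor_def plus_tensor_def minus_tensor_def uminus_tensor_def scaleC_tensor_def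
  by (subst Abs_tensor_inverse;
      auto simp: antilinear_def scaleC_complex_def algebra_simps)+

instance
  by standard (auto intro!: tensor_eqI simp: Rep_tensor_simps algebra_simps)

end

lemma Rep_tensor_sum: "Rep_tensor (sum g A) x y = (\<Sum>i\<in>A. Rep_tensor (g i) x y)"
  by (induction A rule: infinite_finite_induct) (auto simp: Rep_tensor_simps)

lemma tensor_expand:
  assumes "orthonormal_basis E" "orthonormal_basis E'"
  shows "(\<Sum>e\<in>E. \<Sum>f\<in>E'. Rep_tensor F e f *\<^sub>C (e \<otimes>\<^sub>v f)) = F"
proof (rule tensor_eqI)
  fix x y
  have "Rep_tensor F x y
      = Rep_tensor F (\<Sum>e\<in>E. \<langle>e, x\<rangle> *\<^sub>C e) (\<Sum>f\<in>E'. \<langle>f, y\<rangle> *\<^sub>C f)"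
    using assms by (simp only: onb_expand)
  also have "\<dots> = (\<Sum>f\<in>E'. Rep_tensor F (\<Sum>e\<in>E. \<langle>e, x\<rangle> *\<^sub>C e) (\<langle>f, y\<rangle> *\<^sub>C f))"
    by (rule antilinear_sum[OF Rep_tensor_antilinear(1)])
  also have "\<dots> = (\<Sum>f\<in>E'. \<Sum>e\<in>E. Rep_tensor F (\<langle>e, x\<rangle> *\<^sub>C e) (\<langle>f, y\<rangle> *\<^sub>C f))"
    by (intro sum.cong refl antilinear_sum[OF Rep_tensor_antilinear(2)])
  also have "\<dots> = (\<Sum>f\<in>E'. \<Sum>e\<in>E. \<langle>x, e\<rangle> * \<langle>y, f\<rangle> * Rep_tensor F e f)"
    using Rep_tensor_antilinear[of F]
    by (simp add: antilinear_def scaleC_complex_def cinner_commute[symmetric] algebra_simps)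
  also have "\<dots> = (\<Sum>e\<in>E. \<Sum>f\<in>E'. \<langle>x, e\<rangle> * \<langle>y, f\<rangle> * Rep_tensor F e f)"
    by (rule sum.swap)
  finally show "Rep_tensor (\<Sum>e\<in>E. \<Sum>f\<in>E'. Rep_tensor F e f *\<^sub>C (e \<otimes>\<^sub>v f)) x y = Rep_tensor F x y"
    by (simp add: Rep_tensor_sum Rep_tensor_simps Rep_tensor_vec algebra_simps)
qed

instantiation tensor :: (fd_hilbert, fd_hilbert) fd_hilbert
begin

definition cinner_tensor :: "('a, 'b) tensor \<Rightarrow> ('a, 'b) tensor \<Rightarrow> complex" where
  "\<langle>F, G\<rangle> = (\<Sum>e\<in>some_onb. \<Sum>f\<in>some_onb. cnj (Rep_tensor F e f) * Rep_tensor G e f)"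

instance
proof
  fix x y z :: "('a, 'b) tensor" and c :: complex
  show "\<langle>x, y\<rangle> = cnj \<langle>y, x\<rangle>" by (simp add: cinner_tensor_def mult.commute)
  show "\<langle>x, y + z\<rangle> = \<langle>x, y\<rangle> + \<langle>x, z\<rangle>"
    by (simp add: cinner_tensor_def Rep_tensor_simps algebra_simps sum.distrib)
  show "\<langle>x, c *\<^sub>C y\<rangle> = c * \<langle>x, y\<rangle>"
    by (simp add: cinner_tensor_def Rep_tensor_simps algebra_simps sum_distrib_left)
  have R: "Re \<langle>x, x\<rangle> = (\<Sum>e\<in>some_onb. \<Sum>f\<in>some_onb. (cmod (Rep_tensor x e f))\<^sup>2)"
    by (simp add: cinner_tensor_def cmod_power2) (simp add: power2_eq_square)
  show "0 \<le> Re \<langle>x, x\<rangle>" unfolding R by (intro sum_nonneg) auto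
  have fin: "finite (some_onb :: 'a set)" "finite (some_onb :: 'b set)"
    using some_onb unfolding orthonormal_basis_def by auto
  {
    assume "\<langle>x, x\<rangle> = 0"
    then have 0: "(\<Sum>e\<in>some_onb. \<Sum>f\<in>some_onb. (cmod (Rep_tensor x e f))\<^sup>2) = 0" using R by simp
    have "Rep_tensor x e f = 0" if "e \<in> some_onb" "f \<in> some_onb" for e f
    proof -
      have "(\<Sum>f\<in>some_onb. (cmod (Rep_tensor x e f))\<^sup>2) = 0"
        using 0 fin that by (subst (asm) sum_nonneg_eq_0_iff) (auto intro!: sum_nonneg)
      then show ?thesis
        using fin that by (subst (asm) sum_nonneg_eq_0_iff) auto
    qed
    then show "x = 0"
      by (subst tensor_expand[OF some_onb some_onb, symmetric]) simp
  }
  let ?B = "(\<lambda>(e, f). e \<otimes>\<^sub>v f) ` (some_onb \<times> some_onb) :: ('a, 'b) tensor set"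
  have finB: "finite ?B" using fin by auto
  have "F \<in> cspan ?B" for F :: "('a, 'b) tensor"
  proof -
    have "(\<Sum>e\<in>some_onb. \<Sum>f\<in>some_onb. Rep_tensor F e f *\<^sub>C (e \<otimes>\<^sub>v f)) \<in> cspan ?B"
      by (intro complex_vector.span_sum complex_vector.span_scale complex_vector.span_base) auto
    then show ?thesis by (simp only: tensor_expand[OF some_onb some_onb])
  qed
  then show "\<exists>B :: ('a, 'b) tensor set. finite B \<and> (\<forall>x. \<exists>c. x = (\<Sum>b\<in>B. c b *\<^sub>C b))"
    using finB unfolding complex_vector.span_finite[OF finB] by blast
qed

end

lemma tensor_bilinear: "cbilinear (\<otimes>\<^sub>v)"
  unfolding cbilinear_def clinear_iff
  by (auto intro!: tensor_eqI simp: Rep_tensor_simps Rep_tensor_vec cinner_simps algebra_simps)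

lemma tensor_vec_simps:
  "(x + y) \<otimes>\<^sub>v z = x \<otimes>\<^sub>v z + y \<otimes>\<^sub>v z" "z \<otimes>\<^sub>v (x + y) = z \<otimes>\<^sub>v x + z \<otimes>\<^sub>v y"
  "(c *\<^sub>C x) \<otimes>\<^sub>v z = c *\<^sub>C (x \<otimes>\<^sub>v z)" "z \<otimes>\<^sub>v (c *\<^sub>C x) = c *\<^sub>C (z \<otimes>\<^sub>v x)"
  using tensor_bilinear unfolding cbilinear_def clinear_iff by blast+

lemma cinner_tensor_vec_left: "\<langle>v \<otimes>\<^sub>v w, F\<rangle> = Rep_tensor F v w"
proof -
  have "\<langle>v \<otimes>\<^sub>v w, F\<rangle> = (\<Sum>e\<in>some_onb. \<Sum>f\<in>some_onb. \<langle>v, e\<rangle> * \<langle>w, f\<rangle> * Rep_tensor F e f)"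
    by (simp add: cinner_tensor_def Rep_tensor_vec cinner_commute[symmetric])
  also have "\<dots> = Rep_tensor (\<Sum>e\<in>some_onb. \<Sum>f\<in>some_onb. Rep_tensor F e f *\<^sub>C (e \<otimes>\<^sub>v f)) v w"
    by (simp add: Rep_tensor_sum Rep_tensor_simps Rep_tensor_vec algebra_simps)
  finally show ?thesis by (simp only: tensor_expand[OF some_onb some_onb])
qed

lemma cinner_tensor: "\<langle>v \<otimes>\<^sub>v w, v' \<otimes>\<^sub>v w'\<rangle> = \<langle>v, v'\<rangle> * \<langle>w, w'\<rangle>"
  by (simp add: cinner_tensor_vec_left Rep_tensor_vec)

lemma tensor_span: "cspan {v \<otimes>\<^sub>v w | v w. True} = UNIV"
proof -
  have "F \<in> cspan {v \<otimes>\<^sub>v w | v w. True}" for F :: "('a::fd_hilbert, 'b::fd_hilbert) tensor"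
    by (subst tensor_expand[OF some_onb some_onb, symmetric],
        intro complex_vector.span_sum complex_vector.span_scale complex_vector.span_base) auto
  then show ?thesis by auto
qed

lemma clinear_tensor_ext:
  assumes "clinear L" "clinear M" "\<And>v w. L (v \<otimes>\<^sub>v w) = M (v \<otimes>\<^sub>v w)"
  shows "L = M"
proof
  fix F
  have "L (\<Sum>e\<in>some_onb. \<Sum>f\<in>some_onb. Rep_tensor F e f *\<^sub>C (e \<otimes>\<^sub>v f))
      = M (\<Sum>e\<in>some_onb. \<Sum>f\<in>some_onb. Rep_tensor F e f *\<^sub>C (e \<otimes>\<^sub>v f))"
    using assms by (simp add: clinear_sum) (simp add: clinear_iff)
  then show "L F = M F" by (simp only: tensor_expand[OF some_onb some_onb])
qed

text \<open>The linear map induced by a bilinear map, by the universal property.\<close>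

definition tensor_lift ::
  "('a::fd_hilbert \<Rightarrow> 'b::fd_hilbert \<Rightarrow> 'c::complex_vector) \<Rightarrow> ('a, 'b) tensor \<Rightarrow> 'c" where
  "tensor_lift \<beta> = (THE L. clinear L \<and> (\<forall>v w. L (v \<otimes>\<^sub>v w) = \<beta> v w))"

lemma tensor_lift_ex1:
  assumes "cbilinear \<beta>"
  shows "\<exists>!L. clinear L \<and> (\<forall>v w. L (v \<otimes>\<^sub>v w) = \<beta> v w)"
proof (rule ex_ex1I)
  let ?L = "\<lambda>F. \<Sum>e\<in>some_onb. \<Sum>f\<in>some_onb. Rep_tensor F e f *\<^sub>C \<beta> e f"
  have "clinear ?L"
    by (simp add: clinear_iff Rep_tensor_simps scaleC_add_left sum.distrib
        complex_vector.scale_sum_right scaleC_scaleC)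
  moreover have "?L (v \<otimes>\<^sub>v w) = \<beta> v w" for v w
  proof -
    have l: "clinear (\<beta> v)" "clinear (\<lambda>v. \<beta> v w)" for v w
      using assms by (auto simp: cbilinear_def)
    have "\<beta> v w = \<beta> (\<Sum>e\<in>some_onb. \<langle>e, v\<rangle> *\<^sub>C e) (\<Sum>f\<in>some_onb. \<langle>f, w\<rangle> *\<^sub>C f)"
      by (simp only: onb_expand[OF some_onb])
    also have "\<dots> = (\<Sum>e\<in>some_onb. \<beta> (\<langle>e, v\<rangle> *\<^sub>C e) (\<Sum>f\<in>some_onb. \<langle>f, w\<rangle> *\<^sub>C f))"
      by (rule clinear_sum[OF l(2)])
    also have "\<dots> = (\<Sum>e\<in>some_onb. \<Sum>f\<in>some_onb. \<beta> (\<langle>e, v\<rangle> *\<^sub>C e) (\<langle>f, w\<rangle> *\<^sub>C f))"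
      by (intro sum.cong refl clinear_sum[OF l(1)])
    also have "\<dots> = ?L (v \<otimes>\<^sub>v w)"
      using l by (simp add: clinear_iff Rep_tensor_vec scaleC_scaleC mult.commute)
    finally show ?thesis by simp
  qed
  ultimately show "\<exists>L. clinear L \<and> (\<forall>v w. L (v \<otimes>\<^sub>v w) = \<beta> v w)" by blast
qed (auto intro: clinear_tensor_ext)

lemma tensor_lift:
  assumes "cbilinear \<beta>"
  shows "clinear (tensor_lift \<beta>)" "tensor_lift \<beta> (v \<otimes>\<^sub>v w) = \<beta> v w"
  using theI'[OF tensor_lift_ex1[OF assms]] unfolding tensor_lift_def by blast+

definition tensor_map ::
  "('a::fd_hilbert \<Rightarrow> 'c::fd_hilbert) \<Rightarrow> ('b::fd_hilbert \<Rightarrow> 'd::fd_hilbert)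
    \<Rightarrow> ('a, 'b) tensor \<Rightarrow> ('c, 'd) tensor"  (infixr "\<otimes>\<^sub>o" 70) where
  "A \<otimes>\<^sub>o B = tensor_lift (\<lambda>v w. A v \<otimes>\<^sub>v B w)"

text \<open>
  Associator and unitors, which are identities when the tensor category of Hilbert spaces is
  treated as strict.
\<close>

definition assoc ::
  "(('a::fd_hilbert, 'b::fd_hilbert) tensor, 'c::fd_hilbert) tensor \<Rightarrow> ('a, ('b, 'c) tensor) tensor" where
  "assoc = tensor_lift (\<lambda>F w. tensor_lift (\<lambda>u v. u \<otimes>\<^sub>v (v \<otimes>\<^sub>v w)) F)"

definition assoc_inv ::
  "('a::fd_hilbert, ('b::fd_hilbert, 'c::fd_hilbert) tensor) tensor \<Rightarrow> (('a, 'b) tensor, 'c) tensor" where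
  "assoc_inv = tensor_lift (\<lambda>u F. tensor_lift (\<lambda>v w. (u \<otimes>\<^sub>v v) \<otimes>\<^sub>v w) F)"

definition lunit :: "(complex, 'a::fd_hilbert) tensor \<Rightarrow> 'a" where
  "lunit = tensor_lift (\<lambda>c v. c *\<^sub>C v)"

definition lunit_inv :: "'a::fd_hilbert \<Rightarrow> (complex, 'a) tensor" where
  "lunit_inv v = 1 \<otimes>\<^sub>v v"

definition runit :: "('a::fd_hilbert, complex) tensor \<Rightarrow> 'a" where
  "runit = tensor_lift (\<lambda>v c. c *\<^sub>C v)"

definition runit_inv :: "'a::fd_hilbert \<Rightarrow> ('a, complex) tensor" where
  "runit_inv v = v \<otimes>\<^sub>v 1"

lemma tensor_map:
  assumes "clinear A" "clinear B"
  shows "clinear (A \<otimes>\<^sub>o B)" "(A \<otimes>\<^sub>o B) (v \<otimes>\<^sub>v w) = A v \<otimes>\<^sub>v B w"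
proof -
  have "cbilinear (\<lambda>v w. A v \<otimes>\<^sub>v B w)"
    using assms by (simp add: cbilinear_def clinear_iff tensor_vec_simps)
  note * = tensor_lift[OF this]
  show "clinear (A \<otimes>\<^sub>o B)" "(A \<otimes>\<^sub>o B) (v \<otimes>\<^sub>v w) = A v \<otimes>\<^sub>v B w"
    unfolding tensor_map_def by (fact *)+
qed

lemma assoc:
  fixes u :: "'a::fd_hilbert" and v :: "'b::fd_hilbert" and w :: "'c::fd_hilbert"
  shows "clinear (assoc :: (('a, 'b) tensor, 'c) tensor \<Rightarrow> _)"
    "assoc ((u \<otimes>\<^sub>v v) \<otimes>\<^sub>v w) = u \<otimes>\<^sub>v (v \<otimes>\<^sub>v w)"
proof -
  have b: "cbilinear (\<lambda>u v. u \<otimes>\<^sub>v (v \<otimes>\<^sub>v w))" for w :: 'c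
    by (simp add: cbilinear_def clinear_iff tensor_vec_simps)
  define t where "t = (\<lambda>w::'c. tensor_lift (\<lambda>(u::'a) (v::'b). u \<otimes>\<^sub>v (v \<otimes>\<^sub>v w)))"
  have m: "clinear (t w)" "t w (u \<otimes>\<^sub>v v) = u \<otimes>\<^sub>v (v \<otimes>\<^sub>v w)" for u v w
    unfolding t_def using tensor_lift[OF b] by auto
  have "t (w + w') = (\<lambda>F. t w F + t w' F)" for w w'
    by (rule clinear_tensor_ext)
      (use m in \<open>auto simp: clinear_iff tensor_vec_simps scaleC_add_right\<close>)
  moreover have "t (c *\<^sub>C w) = (\<lambda>F. c *\<^sub>C t w F)" for c w
    by (rule clinear_tensor_ext)
      (use m in \<open>auto simp: clinear_iff tensor_vec_simps scaleC_add_right scaleC_scaleC mult.commute\<close>)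
  ultimately have "cbilinear (\<lambda>F w. t w F)"
    using m(1) by (simp add: cbilinear_def clinear_iff)
  note * = tensor_lift[OF this]
  show "clinear (assoc :: (('a, 'b) tensor, 'c) tensor \<Rightarrow> _)" unfolding assoc_def by (fact *(1)[unfolded t_def])
  have t: "tensor_lift (\<lambda>(u::'a) (v::'b). u \<otimes>\<^sub>v (v \<otimes>\<^sub>v w)) = t w" for w :: 'c
    by (simp add: t_def)
  show "assoc ((u \<otimes>\<^sub>v v) \<otimes>\<^sub>v w) = u \<otimes>\<^sub>v (v \<otimes>\<^sub>v w)"
    by (simp only: assoc_def t * m)
qed

lemma assoc_inv:
  fixes u :: "'a::fd_hilbert" and v :: "'b::fd_hilbert" and w :: "'c::fd_hilbert"
  shows "clinear (assoc_inv :: ('a, ('b, 'c) tensor) tensor \<Rightarrow> _)"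
    "assoc_inv (u \<otimes>\<^sub>v (v \<otimes>\<^sub>v w)) = (u \<otimes>\<^sub>v v) \<otimes>\<^sub>v w"
proof -
  have b: "cbilinear (\<lambda>v w. (u \<otimes>\<^sub>v v) \<otimes>\<^sub>v w)" for u :: 'a
    by (simp add: cbilinear_def clinear_iff tensor_vec_simps)
  define t where "t = (\<lambda>u::'a. tensor_lift (\<lambda>(v::'b) (w::'c). (u \<otimes>\<^sub>v v) \<otimes>\<^sub>v w))"
  have m: "clinear (t u)" "t u (v \<otimes>\<^sub>v w) = (u \<otimes>\<^sub>v v) \<otimes>\<^sub>v w" for u v w
    unfolding t_def using tensor_lift[OF b] by auto
  have "t (u + u') = (\<lambda>F. t u F + t u' F)" for u u'
    by (rule clinear_tensor_ext)
      (use m in \<open>auto simp: clinear_iff tensor_vec_simps scaleC_add_right\<close>)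
  moreover have "t (c *\<^sub>C u) = (\<lambda>F. c *\<^sub>C t u F)" for c u
    by (rule clinear_tensor_ext)
      (use m in \<open>auto simp: clinear_iff tensor_vec_simps scaleC_add_right scaleC_scaleC mult.commute\<close>)
  ultimately have "cbilinear t"
    using m(1) by (simp add: cbilinear_def clinear_iff)
  note * = tensor_lift[OF this]
  show "clinear (assoc_inv :: ('a, ('b, 'c) tensor) tensor \<Rightarrow> _)" unfolding assoc_inv_def by (fact *(1)[unfolded t_def])
  have t: "tensor_lift (\<lambda>(v::'b) (w::'c). (u \<otimes>\<^sub>v v) \<otimes>\<^sub>v w) = t u" for u :: 'a
    by (simp add: t_def)
  show "assoc_inv (u \<otimes>\<^sub>v (v \<otimes>\<^sub>v w)) = (u \<otimes>\<^sub>v v) \<otimes>\<^sub>v w"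
    by (simp only: assoc_inv_def t * m)
qed

lemma unitors:
  fixes v :: "'a::fd_hilbert"
  shows "clinear (lunit :: (complex, 'a) tensor \<Rightarrow> 'a)" "lunit (c \<otimes>\<^sub>v v) = c *\<^sub>C v"
    "clinear (runit :: ('a, complex) tensor \<Rightarrow> 'a)" "runit (v \<otimes>\<^sub>v c) = c *\<^sub>C v"
    "clinear (lunit_inv :: 'a \<Rightarrow> _)" "clinear (runit_inv :: 'a \<Rightarrow> _)"
proof -
  have "cbilinear (\<lambda>c (v::'a). c *\<^sub>C v)" "cbilinear (\<lambda>(v::'a) c. c *\<^sub>C v)"
    by (simp_all add: cbilinear_def clinear_iff scaleC_add_left scaleC_add_right scaleC_scaleC
        scaleC_complex_def mult.commute)
  note * = this[THEN tensor_lift(1)] this[THEN tensor_lift(2)]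
  show "clinear (lunit :: (complex, 'a) tensor \<Rightarrow> 'a)" "lunit (c \<otimes>\<^sub>v v) = c *\<^sub>C v"
    "clinear (runit :: ('a, complex) tensor \<Rightarrow> 'a)" "runit (v \<otimes>\<^sub>v c) = c *\<^sub>C v"
    unfolding lunit_def runit_def by (fact *)+
  show "clinear (lunit_inv :: 'a \<Rightarrow> _)" "clinear (runit_inv :: 'a \<Rightarrow> _)"
    unfolding lunit_inv_def runit_inv_def by (simp_all add: clinear_iff tensor_vec_simps)
qed


section \<open>Conjugate equations and crossing maps\<close>

definition antilinear_involution :: "('a::complex_vector \<Rightarrow> 'a) \<Rightarrow> bool" where
  "antilinear_involution S \<longleftrightarrow> antilinear S \<and> S \<circ> S = id"

definition conjugate_equations ::
  "(('a::fd_hilbert, 'a) tensor \<Rightarrow> complex) \<Rightarrow> (complex \<Rightarrow> ('a, 'a) tensor) \<Rightarrow> bool" where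
  "conjugate_equations ev coev \<longleftrightarrow>
     runit \<circ> (id \<otimes>\<^sub>o ev) \<circ> assoc \<circ> (coev \<otimes>\<^sub>o id) \<circ> lunit_inv = (id :: 'a \<Rightarrow> 'a) \<and>
     lunit \<circ> (ev \<otimes>\<^sub>o id) \<circ> assoc_inv \<circ> (id \<otimes>\<^sub>o coev) \<circ> runit_inv = (id :: 'a \<Rightarrow> 'a)"

definition conjugate_solution ::
  "(('a::fd_hilbert, 'a) tensor \<Rightarrow> complex) \<Rightarrow> (complex \<Rightarrow> ('a, 'a) tensor) \<Rightarrow> bool" where
  "conjugate_solution ev coev \<longleftrightarrow>
     clinear ev \<and> clinear coev \<and> coev = cadjoint ev \<and> conjugate_equations ev coev"

text \<open>
  The reassociations turn \<open>(\<H> \<otimes> \<H>) \<otimes> (\<H> \<otimes> \<H>)\<close> into \<open>\<H> \<otimes> ((\<H> \<otimes> \<H>) \<otimes> \<H>)\<close> and back.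
\<close>

definition CatCr ::
  "(('a::fd_hilbert, 'a) tensor \<Rightarrow> complex) \<Rightarrow> (complex \<Rightarrow> ('a, 'a) tensor)
    \<Rightarrow> (('a, 'a) tensor \<Rightarrow> ('a, 'a) tensor) \<Rightarrow> ('a, 'a) tensor \<Rightarrow> ('a, 'a) tensor" where
  "CatCr ev coev T =
     runit \<circ> (id \<otimes>\<^sub>o ev)
       \<circ> (assoc_inv \<circ> (id \<otimes>\<^sub>o assoc)) \<circ> (id \<otimes>\<^sub>o (T \<otimes>\<^sub>o id)) \<circ> ((id \<otimes>\<^sub>o assoc_inv) \<circ> assoc)
       \<circ> (coev \<otimes>\<^sub>o id) \<circ> lunit_inv"

definition Cr ::
  "('a::fd_hilbert \<Rightarrow> 'a) \<Rightarrow> (('a, 'a) tensor \<Rightarrow> ('a, 'a) tensor) \<Rightarrow> ('a, 'a) tensor \<Rightarrow> ('a, 'a) tensor" where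
  "Cr S T = (THE R. clinear R \<and>
     (\<forall>\<phi>1 \<phi>2 \<psi>1 \<psi>2. \<langle>\<phi>1 \<otimes>\<^sub>v \<phi>2, R (\<psi>1 \<otimes>\<^sub>v \<psi>2)\<rangle> = \<langle>\<phi>2 \<otimes>\<^sub>v antiadjoint S \<psi>2, T (S \<phi>1 \<otimes>\<^sub>v \<psi>1)\<rangle>))"

lemma Cr_ex1:
  fixes S :: "'a::fd_hilbert \<Rightarrow> 'a"
  assumes "antilinear S" "clinear T"
  shows "\<exists>!R. clinear R \<and>
     (\<forall>\<phi>1 \<phi>2 \<psi>1 \<psi>2. \<langle>\<phi>1 \<otimes>\<^sub>v \<phi>2, R (\<psi>1 \<otimes>\<^sub>v \<psi>2)\<rangle> = \<langle>\<phi>2 \<otimes>\<^sub>v antiadjoint S \<psi>2, T (S \<phi>1 \<otimes>\<^sub>v \<psi>1)\<rangle>)"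
    (is "\<exists>!R. clinear R \<and> ?P R")
proof (rule ex_ex1I)
  note aa = antiadjoint[OF assms(1), symmetric]
  have S': "antilinear (antiadjoint S)"
    unfolding antilinear_def
    by (intro conjI allI; rule cinner_ext) (simp_all add: cinner_simps aa)
  let ?G = "\<lambda>\<psi>1 \<psi>2 \<phi>1 \<phi>2. \<langle>\<phi>2 \<otimes>\<^sub>v antiadjoint S \<psi>2, T (S \<phi>1 \<otimes>\<^sub>v \<psi>1)\<rangle>"
  define K where "K = (\<lambda>\<psi>1 \<psi>2. Abs_tensor (?G \<psi>1 \<psi>2))"
  have K: "Rep_tensor (K \<psi>1 \<psi>2) \<phi>1 \<phi>2 = ?G \<psi>1 \<psi>2 \<phi>1 \<phi>2" for \<psi>1 \<psi>2 \<phi>1 \<phi>2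
  proof -
    have "Rep_tensor (K \<psi>1 \<psi>2) = ?G \<psi>1 \<psi>2"
      unfolding K_def using assms S'
      by (intro Abs_tensor_inverse)
        (simp add: antilinear_def clinear_iff tensor_vec_simps cinner_simps scaleC_complex_def)
    then show ?thesis by simp
  qed
  have "cbilinear K"
    using assms S' unfolding cbilinear_def clinear_iff antilinear_def
    by (auto intro!: tensor_eqI simp: K Rep_tensor_simps tensor_vec_simps cinner_simps)
  note L = tensor_lift[OF this]
  have "clinear (tensor_lift K) \<and> ?P (tensor_lift K)"
    using L by (simp add: cinner_tensor_vec_left K)
  then show "\<exists>R. clinear R \<and> ?P R" by blast
next
  fix R R' assume "clinear R \<and> ?P R" "clinear R' \<and> ?P R'"
  then show "R = R'"
    by (intro clinear_tensor_ext tensor_eqI) (auto simp: cinner_tensor_vec_left[symmetric])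
qed

end

(* By the Riesz representation, linear functionals ev on H \<otimes> H are the same as antilinear maps S on H,
   via ev (v \<otimes> w) = <S v, w>, and then ev^* 1 = \<Sum> e \<otimes> S e over any orthonormal basis.  With these
   formulas one zig-zag composite is S \<circ> S and the other is its adjoint, so the conjugate equations say exactly that
   S is an involution.  Evaluating CatCr on \<psi>1 \<otimes> \<psi>2 gives \<Sum> e \<otimes> (1 \<otimes> ev) (T (S e \<otimes> \<psi>1) \<otimes> \<psi>2);
   pairing with \<phi>1 \<otimes> \<phi>2 collapses the sum by antilinearity of S to the defining formula of Cr. *)
theory Submission
  imports Defs
begin

lemma scaleC_complex: "a *\<^sub>C b = a * (b :: complex)"
  by (simp add: scaleC_complex_def)

lemma clinear_compose: "clinear f \<Longrightarrow> clinear g \<Longrightarrow> clinear (f \<circ> g)"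
  by (simp add: clinear_iff)

lemma clinear_id: "clinear id"
  by (simp add: clinear_iff)

lemma clinear_scaleC: "clinear f \<Longrightarrow> f (c *\<^sub>C x) = c *\<^sub>C f x"
  by (simp add: clinear_iff)

lemma tensor_vec_sum:
  "(\<Sum>i\<in>A. f i) \<otimes>\<^sub>v w = (\<Sum>i\<in>A. f i \<otimes>\<^sub>v w)" "v \<otimes>\<^sub>v (\<Sum>i\<in>A. g i) = (\<Sum>i\<in>A. v \<otimes>\<^sub>v g i)"
  using clinear_sum[of "\<lambda>v. v \<otimes>\<^sub>v w" f A] clinear_sum[of "(\<otimes>\<^sub>v) v" g A]
  by (simp_all add: clinear_iff tensor_vec_simps)

lemma cinner_ext_left: "(\<And>x. \<langle>y, x\<rangle> = \<langle>z, x\<rangle>) \<Longrightarrow> y = z"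
  by (rule cinner_ext) (metis cinner_commute)

lemma clinear_cinner_right: "clinear f \<Longrightarrow> clinear (\<lambda>x. \<langle>v, f x\<rangle>)"
  by (simp add: clinear_iff cinner_add_right cinner_scaleC_right scaleC_complex)

text \<open>Antilinearity conjugates the Fourier coefficients \<open>\<langle>e, x\<rangle>\<close>.
  Read from left to right, this collapses the basis sums coming from the coevaluation, leaving
  \<open>S\<close> at a single vector.\<close>

lemma antilinear_onb_expand:
  assumes "antilinear S" "orthonormal_basis E"
  shows "(\<Sum>e\<in>E. \<langle>x, e\<rangle> *\<^sub>C S e) = S x"
proof -
  have "S x = S (\<Sum>e\<in>E. \<langle>e, x\<rangle> *\<^sub>C e)"
    by (simp only: onb_expand[OF assms(2)])
  also have "\<dots> = (\<Sum>e\<in>E. \<langle>x, e\<rangle> *\<^sub>C S e)"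
    using assms(1)
    by (simp add: antilinear_sum) (simp add: antilinear_def cinner_commute[symmetric])
  finally show ?thesis by simp
qed

lemma clinear_cadjoint:
  assumes "clinear A"
  shows "clinear (cadjoint A)"
  unfolding clinear_iff
  by (intro conjI allI; rule cinner_ext_left)
    (simp_all add: cinner_simps cadjoint[OF assms, symmetric])

text \<open>The evaluation attached to \<open>S\<close>. It makes sense for every antilinear
  \<open>S\<close>, so that being an involution can be read off later from the conjugate
  equations.\<close>

definition antilinear_ev :: "('a::fd_hilbert \<Rightarrow> 'a) \<Rightarrow> ('a, 'a) tensor \<Rightarrow> complex" where
  "antilinear_ev S = tensor_lift (\<lambda>v w. \<langle>S v, w\<rangle>)"

lemma antilinear_ev:
  assumes "antilinear S"
  shows "clinear (antilinear_ev S)" "antilinear_ev S (v \<otimes>\<^sub>v w) = \<langle>S v, w\<rangle>"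
proof -
  have "cbilinear (\<lambda>v w. \<langle>S v, w\<rangle>)"
    using assms
    by (simp add: cbilinear_def clinear_iff antilinear_def cinner_simps scaleC_complex)
  note * = tensor_lift[OF this]
  show "clinear (antilinear_ev S)" "antilinear_ev S (v \<otimes>\<^sub>v w) = \<langle>S v, w\<rangle>"
    unfolding antilinear_ev_def by (fact *)+
qed

text \<open>Riesz representation in the second tensor factor: each \<open>v\<close> gives a
  functional of \<open>w\<close>, and its representing vector depends antilinearly on
  \<open>v\<close> because the inner product is antilinear on the left.\<close>

lemma clinear_functional_eq_antilinear_ev:
  fixes ev :: "('a::fd_hilbert, 'a) tensor \<Rightarrow> complex"
  assumes "clinear ev"
  obtains S where "antilinear S" "ev = antilinear_ev S"
proof -
  \<comment> \<open>The adjoint of a functional sends 1 to its Riesz vector, since pairing with 1 in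
    the complex numbers is the identity.\<close>
  define S where "S v = cadjoint (\<lambda>w. ev (v \<otimes>\<^sub>v w)) 1" for v
  have "clinear (\<lambda>w. ev (v \<otimes>\<^sub>v w))" for v
    using assms by (simp add: clinear_iff tensor_vec_simps)
  from cadjoint[OF this, of 1, symmetric] have S: "\<langle>S v, w\<rangle> = ev (v \<otimes>\<^sub>v w)" for v w
    by (simp add: S_def cinner_complex_def)
  have "antilinear S"
    unfolding antilinear_def
    by (intro conjI allI; rule cinner_ext_left)
      (use assms in \<open>simp_all add: cinner_simps S tensor_vec_simps clinear_iff scaleC_complex\<close>)
  moreover from this have "ev = antilinear_ev S"
    by (intro clinear_tensor_ext assms) (simp_all add: antilinear_ev S)
  ultimately show thesis by (rule that)
qed

lemma inj_antilinear_ev: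
  assumes "antilinear S" "antilinear S'" "antilinear_ev S = antilinear_ev S'"
  shows "S = S'"
  by (rule ext, rule cinner_ext_left) (metis antilinear_ev(2) assms)

text \<open>The adjoint is determined by pairing with all \<open>G\<close>; both pairings are linear
  in \<open>G\<close>, so simple tensors suffice. The adjoint does not refer to \<open>E\<close>,
  hence the sum is the same for every orthonormal basis.\<close>

lemma cadjoint_antilinear_ev:
  assumes S: "antilinear S" and E: "orthonormal_basis E"
  shows "cadjoint (antilinear_ev S) c = c *\<^sub>C (\<Sum>e\<in>E. e \<otimes>\<^sub>v S e)"
proof -
  let ?F = "c *\<^sub>C (\<Sum>e\<in>E. e \<otimes>\<^sub>v S e)"
  have "(\<lambda>G. \<langle>c, antilinear_ev S G\<rangle>) = (\<lambda>G. \<langle>?F, G\<rangle>)"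
  proof (rule clinear_tensor_ext)
    fix v w
    have "\<langle>S v, w\<rangle> = (\<Sum>e\<in>E. \<langle>e, v\<rangle> * \<langle>S e, w\<rangle>)"
      by (subst antilinear_onb_expand[OF S E, symmetric])
        (simp add: cinner_simps cinner_commute[symmetric])
    then show "\<langle>c, antilinear_ev S (v \<otimes>\<^sub>v w)\<rangle> = \<langle>?F, v \<otimes>\<^sub>v w\<rangle>"
      by (simp add: antilinear_ev[OF S] cinner_simps cinner_tensor cinner_complex_def)
  next
    show "clinear (\<lambda>G. \<langle>c, antilinear_ev S G\<rangle>)"
      by (rule clinear_cinner_right[OF antilinear_ev(1)[OF S]])
    show "clinear (\<lambda>G. \<langle>?F, G\<rangle>)"
      using clinear_cinner_right[OF clinear_id] by simp
  qed
  then have "\<langle>c, antilinear_ev S G\<rangle> = \<langle>?F, G\<rangle>" for G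
    by (rule fun_cong)
  then show ?thesis
    by - (rule cinner_ext_left, simp only: cadjoint[OF antilinear_ev(1)[OF S], symmetric])
qed

text \<open>Coevaluation produces the sum of \<open>e \<otimes>\<^sub>v S e\<close>, and evaluating
  \<open>S e\<close> against \<open>x\<close> leaves the coefficient of \<open>e\<close>. The result
  is the basis expansion of the adjoint of \<open>S \<circ> S\<close> at \<open>x\<close>.\<close>

lemma zigzag_left:
  fixes S :: "'a::fd_hilbert \<Rightarrow> 'a"
  assumes S: "antilinear S"
  shows "(runit \<circ> (id \<otimes>\<^sub>o antilinear_ev S) \<circ> assoc \<circ> (cadjoint (antilinear_ev S) \<otimes>\<^sub>o id) \<circ> lunit_inv) x
    = (\<Sum>e\<in>some_onb. \<langle>S (S e), x\<rangle> *\<^sub>C e)"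
proof -
  note ev = antilinear_ev[OF S]
  note co = clinear_cadjoint[OF ev(1)]
  note lin = assoc(1) unitors(1,3) tensor_map(1)[OF clinear_id ev(1)]
  show ?thesis
    by (simp add: lunit_inv_def tensor_map(2)[OF co clinear_id] cadjoint_antilinear_ev[OF S some_onb]
        tensor_vec_sum lin[THEN clinear_sum] assoc(2) tensor_map(2)[OF clinear_id ev(1)] ev(2)
        unitors scaleC_one)
qed

text \<open>Here \<open>x\<close> is evaluated against \<open>e\<close>, giving the coefficient
  \<open>\<langle>S x, e\<rangle>\<close> of \<open>S e\<close>; the antilinear expansion sums these
  up.\<close>

lemma zigzag_right:
  fixes S :: "'a::fd_hilbert \<Rightarrow> 'a"
  assumes S: "antilinear S"
  shows "(lunit \<circ> (antilinear_ev S \<otimes>\<^sub>o id) \<circ> assoc_inv \<circ> (id \<otimes>\<^sub>o cadjoint (antilinear_ev S)) \<circ> runit_inv) x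
    = S (S x)"
proof -
  note ev = antilinear_ev[OF S]
  note co = clinear_cadjoint[OF ev(1)]
  note lin = assoc_inv(1) unitors(1,3) tensor_map(1)[OF ev(1) clinear_id]
  show ?thesis
    by (simp add: runit_inv_def tensor_map(2)[OF clinear_id co] cadjoint_antilinear_ev[OF S some_onb]
        tensor_vec_sum lin[THEN clinear_sum] assoc_inv(2) tensor_map(2)[OF ev(1) clinear_id] ev(2)
        unitors scaleC_one antilinear_onb_expand[OF S some_onb])
qed

text \<open>The second zig-zag gives \<open>S \<circ> S = id\<close> directly. Conversely, the first
  one then becomes the ordinary basis expansion of \<open>x\<close>.\<close>

lemma conjugate_solution_antilinear_ev_iff:
  assumes S: "antilinear S"
  shows "conjugate_solution (antilinear_ev S) (cadjoint (antilinear_ev S)) \<longleftrightarrow> S \<circ> S = id"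
proof -
  have "(\<Sum>e\<in>some_onb. \<langle>S (S e), x\<rangle> *\<^sub>C e) = x" if "S \<circ> S = id" for x
    using that onb_expand[OF some_onb, of x] by (simp add: fun_eq_iff)
  then show ?thesis
    unfolding conjugate_solution_def conjugate_equations_def
    using antilinear_ev(1)[OF S] clinear_cadjoint zigzag_left[OF S] zigzag_right[OF S]
    by (auto simp: fun_eq_iff)
qed

lemma CatCr_antilinear_ev:
  fixes S :: "'a::fd_hilbert \<Rightarrow> 'a"
  assumes S: "antilinear S" and T: "clinear T"
  shows "CatCr (antilinear_ev S) (cadjoint (antilinear_ev S)) T = Cr S T"
proof -
  note ev = antilinear_ev[OF S]
  note co = clinear_cadjoint[OF ev(1)]
  let ?R = "CatCr (antilinear_ev S) (cadjoint (antilinear_ev S)) T"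
  \<comment> \<open>\<open>K\<close> is the part of the composite after \<open>T\<close>, and
    \<open>M\<close> below is \<open>T\<close> with the reassociation preceding it.\<close>
  define K where "K = runit \<circ> ((id :: ('a, 'a) tensor \<Rightarrow> _) \<otimes>\<^sub>o antilinear_ev S)
    \<circ> (assoc_inv \<circ> ((id :: 'a \<Rightarrow> _) \<otimes>\<^sub>o assoc))"
  have linK: "clinear K"
    unfolding K_def
    by (intro clinear_compose unitors tensor_map clinear_id ev assoc assoc_inv)
  \<comment> \<open>The final evaluation moves to the left of the inner product as
    \<open>antiadjoint S w\<close>. The value \<open>F\<close> of \<open>T\<close> need not be a
    simple tensor, so linearity in \<open>F\<close> is used to reduce to that case.\<close>
  have K: "\<langle>\<phi>1 \<otimes>\<^sub>v \<phi>2, K (e \<otimes>\<^sub>v (F \<otimes>\<^sub>v w))\<rangle> = \<langle>\<phi>1, e\<rangle> * \<langle>\<phi>2 \<otimes>\<^sub>v antiadjoint S w, F\<rangle>" for \<phi>1 \<phi>2 e w F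
  proof -
    have "(\<lambda>F. \<langle>\<phi>1 \<otimes>\<^sub>v \<phi>2, K (e \<otimes>\<^sub>v (F \<otimes>\<^sub>v w))\<rangle>)
        = (\<lambda>F. \<langle>\<phi>1, e\<rangle> * \<langle>\<phi>2 \<otimes>\<^sub>v antiadjoint S w, F\<rangle>)"
    proof (rule clinear_tensor_ext)
      fix a b
      have "\<langle>S b, w\<rangle> = \<langle>antiadjoint S w, b\<rangle>"
        using antiadjoint[OF S, of w b] by (metis cinner_commute)
      then show "\<langle>\<phi>1 \<otimes>\<^sub>v \<phi>2, K (e \<otimes>\<^sub>v ((a \<otimes>\<^sub>v b) \<otimes>\<^sub>v w))\<rangle>
          = \<langle>\<phi>1, e\<rangle> * \<langle>\<phi>2 \<otimes>\<^sub>v antiadjoint S w, a \<otimes>\<^sub>v b\<rangle>"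
        by (simp add: K_def tensor_map(2) clinear_id ev assoc assoc_inv unitors cinner_simps
            cinner_tensor mult_ac)
    qed (use linK in \<open>simp_all add: clinear_iff tensor_vec_simps cinner_simps scaleC_complex
          algebra_simps\<close>)
    then show ?thesis by (simp add: fun_eq_iff)
  qed
  define M where "M = ((id :: 'a \<Rightarrow> _) \<otimes>\<^sub>o (T \<otimes>\<^sub>o (id :: 'a \<Rightarrow> _))) \<circ> ((id \<otimes>\<^sub>o assoc_inv) \<circ> assoc)"
  have linM: "clinear M"
    unfolding M_def
    by (intro clinear_compose tensor_map clinear_id T assoc assoc_inv)
  have M: "M ((e \<otimes>\<^sub>v f) \<otimes>\<^sub>v (v \<otimes>\<^sub>v w)) = e \<otimes>\<^sub>v (T (f \<otimes>\<^sub>v v) \<otimes>\<^sub>v w)" for e f v w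
    by (simp add: M_def tensor_map clinear_id T assoc assoc_inv)
  have R: "?R = K \<circ> M \<circ> (cadjoint (antilinear_ev S) \<otimes>\<^sub>o id) \<circ> lunit_inv"
    by (simp add: CatCr_def K_def M_def comp_assoc)
  have linR: "clinear ?R"
    unfolding R by (intro clinear_compose linK linM tensor_map co clinear_id unitors)
  have "\<langle>\<phi>1 \<otimes>\<^sub>v \<phi>2, ?R (v \<otimes>\<^sub>v w)\<rangle> = \<langle>\<phi>2 \<otimes>\<^sub>v antiadjoint S w, T (S \<phi>1 \<otimes>\<^sub>v v)\<rangle>" for \<phi>1 \<phi>2 v w
  proof -
    have "\<langle>\<phi>1 \<otimes>\<^sub>v \<phi>2, ?R (v \<otimes>\<^sub>v w)\<rangle>
        = (\<Sum>e\<in>some_onb. \<langle>\<phi>1, e\<rangle> * \<langle>\<phi>2 \<otimes>\<^sub>v antiadjoint S w, T (S e \<otimes>\<^sub>v v)\<rangle>)"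
      by (simp add: R lunit_inv_def tensor_map(2)[OF co clinear_id] scaleC_one tensor_vec_sum
          cadjoint_antilinear_ev[OF S some_onb] clinear_sum[OF linM] clinear_sum[OF linK] M
          cinner_simps K)
    \<comment> \<open>Linearity of \<open>T\<close> carries the sum into its argument, where it is
      the expansion of \<open>S \<phi>1\<close>.\<close>
    also have "\<dots> = \<langle>\<phi>2 \<otimes>\<^sub>v antiadjoint S w, T ((\<Sum>e\<in>some_onb. \<langle>\<phi>1, e\<rangle> *\<^sub>C S e) \<otimes>\<^sub>v v)\<rangle>"
      by (simp add: tensor_vec_sum clinear_sum[OF T] tensor_vec_simps clinear_scaleC[OF T] cinner_simps)
    finally show ?thesis by (simp only: antilinear_onb_expand[OF S some_onb])
  qed
  with linR show ?thesis
    unfolding Cr_def by (intro the1_equality[OF Cr_ex1[OF S T], symmetric]) blast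
qed

theorem theorem6p7:
  shows "\<exists>\<Phi> :: ('h::fd_hilbert \<Rightarrow> 'h)
                 \<Rightarrow> (('h, 'h) tensor \<Rightarrow> complex) \<times> (complex \<Rightarrow> ('h, 'h) tensor).
    bij_betw \<Phi> {S. antilinear_involution S} {(ev, coev). conjugate_solution ev coev} \<and>
    (\<forall>S ev coev. antilinear_involution S \<and> \<Phi> S = (ev, coev) \<longrightarrow>
       (\<forall>v w. ev (v \<otimes>\<^sub>v w) = \<langle>S v, w\<rangle>) \<and>
       (\<forall>E. orthonormal_basis E \<longrightarrow> (\<forall>c. coev c = c *\<^sub>C (\<Sum>e\<in>E. e \<otimes>\<^sub>v S e))) \<and>
       (\<forall>T. clinear T \<longrightarrow> CatCr ev coev T = Cr S T))"
proof (intro exI conjI)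
  \<comment> \<open>The second component is forced by \<open>coev = cadjoint ev\<close>, so
    bijectivity is a question about \<open>ev\<close> alone.\<close>
  let ?\<Phi> = "\<lambda>S :: 'h \<Rightarrow> 'h. (antilinear_ev S, cadjoint (antilinear_ev S))"
  show "bij_betw ?\<Phi> {S. antilinear_involution S} {(ev, coev). conjugate_solution ev coev}"
    unfolding bij_betw_def
  proof
    show "inj_on ?\<Phi> {S. antilinear_involution S}"
      by (auto intro!: inj_onI inj_antilinear_ev simp: antilinear_involution_def)
    show "?\<Phi> ` {S. antilinear_involution S} = {(ev, coev). conjugate_solution ev coev}"
    proof (intro equalityI subsetI; clarsimp)
      fix S :: "'h \<Rightarrow> 'h" assume "antilinear_involution S"
      then show "conjugate_solution (antilinear_ev S) (cadjoint (antilinear_ev S))"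
        by (simp add: antilinear_involution_def conjugate_solution_antilinear_ev_iff)
    next
      fix ev :: "('h, 'h) tensor \<Rightarrow> complex" and coev
      assume sol: "conjugate_solution ev coev"
      then have "clinear ev" and coev: "coev = cadjoint ev"
        by (auto simp: conjugate_solution_def)
      then obtain S where S: "antilinear S" "ev = antilinear_ev S"
        using clinear_functional_eq_antilinear_ev by blast
      then have "antilinear_involution S"
        using sol coev by (simp add: antilinear_involution_def conjugate_solution_antilinear_ev_iff)
      then show "(ev, coev) \<in> ?\<Phi> ` {S. antilinear_involution S}"
        using S coev by auto
    qed
  qed
  show "\<forall>S ev coev. antilinear_involution S \<and> ?\<Phi> S = (ev, coev) \<longrightarrow>
       (\<forall>v w. ev (v \<otimes>\<^sub>v w) = \<langle>S v, w\<rangle>) \<and>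
       (\<forall>E. orthonormal_basis E \<longrightarrow> (\<forall>c. coev c = c *\<^sub>C (\<Sum>e\<in>E. e \<otimes>\<^sub>v S e))) \<and>
       (\<forall>T. clinear T \<longrightarrow> CatCr ev coev T = Cr S T)"
    by (auto simp: antilinear_involution_def antilinear_ev cadjoint_antilinear_ev CatCr_antilinear_ev)
qed

end
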